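(* Let $\Omega\subset\mathbf{C}$ be a domain, let $X:\Omega\to\mathbf{R}^3$ be a regular harmonic parametric surface with Gauss map $\mathbf{n}=\frac{X_x\times X_y}{\|X_x\times X_y\|}:\Omega\to S^2$, and let $\mathcal{K}\ge 1$. If $X$ is $\mathcal{K}$ quasiconformal, then $\mathbf{n}$ is $\mathcal{K}$ quasiconformal, provided that the Gauss map $\mathbf{n}$ is regular.
   Context: A domain is a connected open set; $z=x+iy$, subscripts $x,y$ denote partial derivatives, $\times$ is the cross product and $\|\cdot\|$ the Euclidean norm in $\mathbf{R}^3$. A harmonic surface is a map $X=(a,b,c):\Omega\to\mathbf{R}^3$ whose coordinate functions are harmonic in $(x,y)$; it is regular (an immersion) if $X_x\times X_y\neq0$ at every point. A smooth map $Y:\Omega\to\mathbf{R}^3$ is called $\mathcal{K}$ quasiconformal if $$\|Y_x\|^2+\|Y_y\|^2\le\left(\mathcal{K}+\frac1{\mathcal{K}}\right)\|Y_x\times Y_y\|\quad\text{on }\Omega;$$ injectivity is not required. This is applied to $Y=X$ and to $Y=\mathbf{n}$ (regarded as a map into $S^2\subset\mathbf{R}^3$). The Gauss map $\mathbf{n}$ is called regular if $\mathbf{n}_x\times\mathbf{n}_y$ is not identically zero on some nonempty open subset of $\Omega$ (equivalently, since $\mathbf{n}$ is real analytic and $\Omega$ is connected, not identically zero on $\Omega$). *)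

theory Defs
  imports "HOL-Analysis.Analysis"
begin

text \<open>The parameter domain is a subset of \<^typ>\<open>complex\<close>, with \<open>z = x + i y\<close>.\<close>

definition partial_x :: "(complex \<Rightarrow> 'a::real_normed_vector) \<Rightarrow> complex \<Rightarrow> 'a" where
  "partial_x f z = vector_derivative (\<lambda>t. f (Complex t (Im z))) (at (Re z))"

definition partial_y :: "(complex \<Rightarrow> 'a::real_normed_vector) \<Rightarrow> complex \<Rightarrow> 'a" where
  "partial_y f z = vector_derivative (\<lambda>t. f (Complex (Re z) t)) (at (Im z))"

text \<open>Class \<open>C\<^sup>k\<close> on an open set. Differentiability here is real (Frechet) differentiability;
  requiring it at every level ensures that the partial derivatives exist and do not
  take the arbitrary value of \<^const>\<open>vector_derivative\<close>.\<close>

primrec Ck_on :: "nat \<Rightarrow> complex set \<Rightarrow> (complex \<Rightarrow> 'a::real_normed_vector) \<Rightarrow> bool" where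
  "Ck_on 0 \<Omega> f \<longleftrightarrow> continuous_on \<Omega> f"
| "Ck_on (Suc k) \<Omega> f \<longleftrightarrow>
     (\<forall>z\<in>\<Omega>. f differentiable (at z)) \<and> Ck_on k \<Omega> (partial_x f) \<and> Ck_on k \<Omega> (partial_y f)"

definition smooth_on :: "complex set \<Rightarrow> (complex \<Rightarrow> 'a::real_normed_vector) \<Rightarrow> bool" where
  "smooth_on \<Omega> f \<longleftrightarrow> (\<forall>k. Ck_on k \<Omega> f)"

definition harmonic_on :: "complex set \<Rightarrow> (complex \<Rightarrow> real) \<Rightarrow> bool" where
  "harmonic_on \<Omega> u \<longleftrightarrow> Ck_on 2 \<Omega> u \<and>
     (\<forall>z\<in>\<Omega>. partial_x (partial_x u) z + partial_y (partial_y u) z = 0)"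

definition harmonic_surface :: "complex set \<Rightarrow> (complex \<Rightarrow> real^3) \<Rightarrow> bool" where
  "harmonic_surface \<Omega> X \<longleftrightarrow> (\<forall>i. harmonic_on \<Omega> (\<lambda>z. X z $ i))"

definition regular_surface :: "complex set \<Rightarrow> (complex \<Rightarrow> real^3) \<Rightarrow> bool" where
  "regular_surface \<Omega> X \<longleftrightarrow> (\<forall>z\<in>\<Omega>. cross3 (partial_x X z) (partial_y X z) \<noteq> 0)"

definition gauss_map :: "(complex \<Rightarrow> real^3) \<Rightarrow> complex \<Rightarrow> real^3" where
  "gauss_map X z =
     cross3 (partial_x X z) (partial_y X z) /\<^sub>R norm (cross3 (partial_x X z) (partial_y X z))"

text \<open>Injectivity is not part of quasiconformality here.\<close>

definition quasiconformal_on :: "real \<Rightarrow> complex set \<Rightarrow> (complex \<Rightarrow> real^3) \<Rightarrow> bool" where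
  "quasiconformal_on K \<Omega> Y \<longleftrightarrow> smooth_on \<Omega> Y \<and>
     (\<forall>z\<in>\<Omega>. (norm (partial_x Y z))\<^sup>2 + (norm (partial_y Y z))\<^sup>2
        \<le> (K + 1 / K) * norm (cross3 (partial_x Y z) (partial_y Y z)))"

text \<open>Regularity of a Gauss map is weaker than being an immersion: the cross product of the
  partial derivatives may vanish at some points, but not identically.\<close>

definition regular_gauss_map :: "complex set \<Rightarrow> (complex \<Rightarrow> real^3) \<Rightarrow> bool" where
  "regular_gauss_map \<Omega> n \<longleftrightarrow>
     (\<exists>U. open U \<and> U \<noteq> {} \<and> U \<subseteq> \<Omega> \<and>
        \<not> (\<forall>z\<in>U. cross3 (partial_x n z) (partial_y n z) = 0))"

end

theory Submission
  imports Defs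
begin

text \<open>Write \<open>L = \<^bold>n \<bullet> X\<^sub>x\<^sub>x\<close>, \<open>M = \<^bold>n \<bullet> X\<^sub>x\<^sub>y\<close>; harmonicity gives \<open>\<^bold>n \<bullet> X\<^sub>y\<^sub>y = - L\<close>. Differentiating
  \<open>\<^bold>n \<bullet> X\<^sub>x = \<^bold>n \<bullet> X\<^sub>y = 0\<close> expresses the inner products of \<open>\<^bold>n\<^sub>x, \<^bold>n\<^sub>y\<close> with \<open>X\<^sub>x, X\<^sub>y\<close> through \<open>L, M\<close>.
  As the second fundamental form is a trace-free symmetric matrix, it is a multiple of an
  orthogonal one, so the differentials of \<open>X\<close> and \<open>\<^bold>n\<close> have the same ratio of singular values
  wherever the latter is nonzero: the dilatations agree pointwise.\<close>

section \<open>Partial derivatives\<close>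

lemma has_derivative_imp_has_vector_derivative_x:
  assumes "(f has_derivative D) (at (Complex x y))"
  shows "((\<lambda>t. f (Complex t y)) has_vector_derivative D 1) (at x)"
proof -
  have "((\<lambda>t. Complex t y) has_vector_derivative 1) (at x)"
    unfolding has_vector_derivative_def complex_eq_iff Complex_eq
    by (auto intro!: derivative_eq_intros simp: fun_eq_iff scaleR_conv_of_real)
  from vector_derivative_diff_chain_within[OF this, of f D] assms show ?thesis
    by (simp add: o_def has_derivative_at_withinI)
qed

lemma has_derivative_imp_has_vector_derivative_y:
  assumes "(f has_derivative D) (at (Complex x y))"
  shows "((\<lambda>t. f (Complex x t)) has_vector_derivative D \<i>) (at y)"
proof -
  have "((\<lambda>t. Complex x t) has_vector_derivative \<i>) (at y)"
    unfolding has_vector_derivative_def complex_eq_iff Complex_eq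
    by (auto intro!: derivative_eq_intros simp: fun_eq_iff scaleR_conv_of_real)
  from vector_derivative_diff_chain_within[OF this, of f D] assms show ?thesis
    by (simp add: o_def has_derivative_at_withinI)
qed

text \<open>Evaluating at \<open>1\<close> and \<open>\<i>\<close> turns every rule for Frechet
  derivatives into one for partial derivatives.\<close>

lemma partial_eq_has_derivative:
  assumes "(f has_derivative D) (at z)"
  shows "partial_x f z = D 1" "partial_y f z = D \<i>"
  using vector_derivative_at[OF has_derivative_imp_has_vector_derivative_x[of f D "Re z" "Im z"]]
    vector_derivative_at[OF has_derivative_imp_has_vector_derivative_y[of f D "Re z" "Im z"]] assms
  by (simp_all add: partial_x_def partial_y_def)

lemma differentiable_partial_x:
  assumes "f differentiable (at (Complex x y))"
  shows "((\<lambda>t. f (Complex t y)) has_vector_derivative partial_x f (Complex x y)) (at x)"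
  using assms by (auto simp: differentiable_def partial_eq_has_derivative(1)
      intro: has_derivative_imp_has_vector_derivative_x)

lemma differentiable_partial_y:
  assumes "f differentiable (at (Complex x y))"
  shows "((\<lambda>t. f (Complex x t)) has_vector_derivative partial_y f (Complex x y)) (at y)"
  using assms by (auto simp: differentiable_def partial_eq_has_derivative(2)
      intro: has_derivative_imp_has_vector_derivative_y)

lemma has_derivative_cong_open:
  assumes "open \<Omega>" "z \<in> \<Omega>" "\<And>w. w \<in> \<Omega> \<Longrightarrow> f w = g w"
  shows "(f has_derivative D) (at z) \<longleftrightarrow> (g has_derivative D) (at z)"
  using has_derivative_transform_within_open[OF _ assms(1,2), of f D UNIV g]
    has_derivative_transform_within_open[OF _ assms(1,2), of g D UNIV f] assms(3) by auto

text \<open>The Frechet derivative depends only on values near \<open>z\<close>, so an identity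
  valid on the open set \<Omega> may be differentiated there, whatever the functions do
  elsewhere.\<close>

lemma partial_cong_open:
  assumes "open \<Omega>" "z \<in> \<Omega>" "\<And>w. w \<in> \<Omega> \<Longrightarrow> f w = g w" "f differentiable (at z)"
  shows "partial_x f z = partial_x g z" "partial_y f z = partial_y g z"
proof -
  obtain D where D: "(f has_derivative D) (at z)"
    using assms(4) unfolding differentiable_def by auto
  then have "(g has_derivative D) (at z)"
    using has_derivative_cong_open[OF assms(1-3)] by simp
  with D show "partial_x f z = partial_x g z" "partial_y f z = partial_y g z"
    by (simp_all add: partial_eq_has_derivative)
qed

lemma partial_const: "partial_x (\<lambda>w. c) z = 0" "partial_y (\<lambda>w. c) z = 0"
  by (simp_all add: partial_eq_has_derivative[OF has_derivative_const])

lemma partial_add: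
  assumes "f differentiable (at z)" "g differentiable (at z)"
  shows "partial_x (\<lambda>w. f w + g w) z = partial_x f z + partial_x g z"
    "partial_y (\<lambda>w. f w + g w) z = partial_y f z + partial_y g z"
proof -
  obtain D E where "(f has_derivative D) (at z)" "(g has_derivative E) (at z)"
    using assms unfolding differentiable_def by auto
  then show "partial_x (\<lambda>w. f w + g w) z = partial_x f z + partial_x g z"
    "partial_y (\<lambda>w. f w + g w) z = partial_y f z + partial_y g z"
    using partial_eq_has_derivative[OF has_derivative_add] by (simp_all add: partial_eq_has_derivative)
qed

lemma (in bounded_linear) partial:
  fixes g :: "complex \<Rightarrow> 'a"
  assumes "g differentiable (at z)"
  shows "partial_x (\<lambda>w. f (g w)) z = f (partial_x g z)"
    "partial_y (\<lambda>w. f (g w)) z = f (partial_y g z)"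
proof -
  obtain D where "(g has_derivative D) (at z)"
    using assms unfolding differentiable_def by auto
  then show "partial_x (\<lambda>w. f (g w)) z = f (partial_x g z)"
    "partial_y (\<lambda>w. f (g w)) z = f (partial_y g z)"
    using partial_eq_has_derivative[OF has_derivative] by (simp_all add: partial_eq_has_derivative)
qed

text \<open>Stated for a general bilinear map so that multiplication, scaling, inner product and
  cross product are all covered at once.\<close>

lemma (in bounded_bilinear) partial:
  fixes f :: "complex \<Rightarrow> 'a" and g :: "complex \<Rightarrow> 'b"
  assumes "f differentiable (at z)" "g differentiable (at z)"
  shows "(\<lambda>w. prod (f w) (g w)) differentiable (at z)"
    "partial_x (\<lambda>w. prod (f w) (g w)) z = prod (f z) (partial_x g z) + prod (partial_x f z) (g z)"
    "partial_y (\<lambda>w. prod (f w) (g w)) z = prod (f z) (partial_y g z) + prod (partial_y f z) (g z)"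
proof -
  obtain D E where DE: "(f has_derivative D) (at z)" "(g has_derivative E) (at z)"
    using assms unfolding differentiable_def by auto
  from FDERIV[OF DE]
  show "(\<lambda>w. prod (f w) (g w)) differentiable (at z)"
    unfolding differentiable_def by blast
  show "partial_x (\<lambda>w. prod (f w) (g w)) z = prod (f z) (partial_x g z) + prod (partial_x f z) (g z)"
    "partial_y (\<lambda>w. prod (f w) (g w)) z = prod (f z) (partial_y g z) + prod (partial_y f z) (g z)"
    using partial_eq_has_derivative[OF FDERIV[OF DE]] DE by (simp_all add: partial_eq_has_derivative)
qed

section \<open>Symmetry of the mixed partial derivatives\<close>

text \<open>Two mean value steps: first in \<open>s\<close> for \<open>F s h - F s 0\<close>, then
  in \<open>t\<close> for \<open>G s\<close>.\<close>

lemma double_difference_mvt: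
  fixes F G H :: "real \<Rightarrow> real \<Rightarrow> real"
  assumes "h > 0"
    and G: "\<And>s t. \<lbrakk>0 \<le> s; s \<le> h; 0 \<le> t; t \<le> h\<rbrakk>
          \<Longrightarrow> ((\<lambda>s. F s t) has_real_derivative G s t) (at s)"
    and H: "\<And>s t. \<lbrakk>0 \<le> s; s \<le> h; 0 \<le> t; t \<le> h\<rbrakk>
          \<Longrightarrow> ((\<lambda>t. G s t) has_real_derivative H s t) (at t)"
  shows "\<exists>s t. 0 < s \<and> s < h \<and> 0 < t \<and> t < h \<and> F h h - F h 0 - F 0 h + F 0 0 = h\<^sup>2 * H s t"
proof -
  have "\<exists>s. 0 < s \<and> s < h \<and> (F h h - F h 0) - (F 0 h - F 0 0) = (h - 0) * (G s h - G s 0)"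
    using assms by (intro MVT2 DERIV_diff) auto
  then obtain s where s: "0 < s" "s < h" "(F h h - F h 0) - (F 0 h - F 0 0) = h * (G s h - G s 0)"
    by auto
  have "\<exists>t. 0 < t \<and> t < h \<and> G s h - G s 0 = (h - 0) * H s t"
    using s \<open>h > 0\<close> by (intro MVT2 H) auto
  then obtain t where t: "0 < t" "t < h" "G s h - G s 0 = h * H s t"
    by auto
  have "F h h - F h 0 - F 0 h + F 0 0 = h\<^sup>2 * H s t"
    using s(3) unfolding t(3) by (simp add: power2_eq_square)
  with s t show ?thesis by blast
qed

text \<open>Schwarz's theorem: the double difference over a small square with corner
  \<open>z\<close> is \<open>h\<^sup>2\<close> times a value of either mixed partial near
  \<open>z\<close>, and both are continuous at \<open>z\<close>.\<close>

lemma mixed_partials_eq_real: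
  fixes f :: "complex \<Rightarrow> real"
  assumes "open \<Omega>" "z \<in> \<Omega>" "Ck_on 2 \<Omega> f"
  shows "partial_x (partial_y f) z = partial_y (partial_x f) z"
proof (rule ccontr)
  define P where "P = partial_y (partial_x f)"
  define Q where "Q = partial_x (partial_y f)"
  have df: "f differentiable (at w)" "partial_x f differentiable (at w)"
    "partial_y f differentiable (at w)" if "w \<in> \<Omega>" for w
    using assms(3) that by (auto simp: numeral_2_eq_2)
  have cont: "isCont P z" "isCont Q z"
    using assms by (auto simp: numeral_2_eq_2 P_def Q_def continuous_on_eq_continuous_at)
  assume "partial_x (partial_y f) z \<noteq> partial_y (partial_x f) z"
  \<comment> \<open>Half the gap: a value strictly this close to \<open>P z\<close> cannot equal one
    this close to \<open>Q z\<close>.\<close>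
  then have e: "\<bar>P z - Q z\<bar> / 2 > 0" (is "?e > 0")
    by (simp add: P_def Q_def)
  obtain d where d: "d > 0" "ball z d \<subseteq> \<Omega>"
    using assms openE by blast
  obtain d1 where d1: "d1 > 0" "\<And>w. dist w z < d1 \<Longrightarrow> dist (P w) (P z) < ?e"
    using cont(1) e unfolding continuous_at_eps_delta by blast
  obtain d2 where d2: "d2 > 0" "\<And>w. dist w z < d2 \<Longrightarrow> dist (Q w) (Q z) < ?e"
    using cont(2) e unfolding continuous_at_eps_delta by blast
  \<comment> \<open>The square of side \<open>h\<close> lies within \<open>2 * h\<close> of
    \<open>z\<close>; dividing by 3 keeps this strictly below all three radii.\<close>
  define h where "h = min d (min d1 d2) / 3"
  have h: "h > 0" "2 * h < d" "2 * h < d1" "2 * h < d2"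
    using d d1 d2 by (auto simp: h_def min_def)
  define c where "c s t = Complex (Re z + s) (Im z + t)" for s t
  have dist: "dist (c s t) z \<le> 2 * h" if "0 \<le> s" "s \<le> h" "0 \<le> t" "t \<le> h" for s t
  proof -
    have "dist (c s t) z \<le> \<bar>s\<bar> + \<bar>t\<bar>"
      using cmod_le[of "c s t - z"] by (simp add: c_def dist_norm)
    then show ?thesis using that by simp
  qed
  have mem: "c s t \<in> \<Omega>" if "0 \<le> s" "s \<le> h" "0 \<le> t" "t \<le> h" for s t
    using dist[OF that] h d by (auto simp: dist_commute)
  have shift_x: "((\<lambda>s. g (c s t)) has_real_derivative partial_x g (c s t)) (at s)"
    if "g differentiable (at (c s t))" for g :: "complex \<Rightarrow> real" and s t
    using differentiable_partial_x[OF that[unfolded c_def]]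
      DERIV_at_within_shift[of "\<lambda>x. g (Complex x (Im z + t))" _ "Re z" s UNIV]
    by (simp add: c_def has_real_derivative_iff_has_vector_derivative)
  have shift_y: "((\<lambda>t. g (c s t)) has_real_derivative partial_y g (c s t)) (at t)"
    if "g differentiable (at (c s t))" for g :: "complex \<Rightarrow> real" and s t
    using differentiable_partial_y[OF that[unfolded c_def]]
      DERIV_at_within_shift[of "\<lambda>y. g (Complex (Re z + s) y)" _ "Im z" t UNIV]
    by (simp add: c_def has_real_derivative_iff_has_vector_derivative)
  define \<Delta> where "\<Delta> = f (c h h) - f (c h 0) - f (c 0 h) + f (c 0 0)"
  have "\<exists>s t. 0 < s \<and> s < h \<and> 0 < t \<and> t < h \<and> 
      f (c h h) - f (c h 0) - f (c 0 h) + f (c 0 0) = h\<^sup>2 * P (c s t)"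
    unfolding P_def
    by (rule double_difference_mvt[where F = "\<lambda>s t. f (c s t)" and G = "\<lambda>s t. partial_x f (c s t)"])
      (auto intro!: shift_x shift_y df mem h)
  then obtain s t where st: "0 < s" "s < h" "0 < t" "t < h" "\<Delta> = h\<^sup>2 * P (c s t)"
    by (auto simp: \<Delta>_def)
  \<comment> \<open>Transposing the arguments reverses the order of differentiation but leaves the
    double difference unchanged.\<close>
  have "\<exists>s t. 0 < s \<and> s < h \<and> 0 < t \<and> t < h \<and> 
      f (c h h) - f (c 0 h) - f (c h 0) + f (c 0 0) = h\<^sup>2 * Q (c t s)"
    unfolding Q_def
    by (rule double_difference_mvt[where F = "\<lambda>s t. f (c t s)" and G = "\<lambda>s t. partial_y f (c t s)"])
      (auto intro!: shift_x shift_y df mem h)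
  then obtain s' t' where st': "0 < s'" "s' < h" "0 < t'" "t' < h" "\<Delta> = h\<^sup>2 * Q (c t' s')"
    by (auto simp: \<Delta>_def)
  have "P (c s t) = Q (c t' s')"
    using st(5) st'(5) h by simp
  moreover have "dist (P (c s t)) (P z) < ?e"
    using dist[of s t] st h by (intro d1) auto
  moreover have "dist (Q (c t' s')) (Q z) < ?e"
    using dist[of t' s'] st' h by (intro d2) auto
  ultimately show False
    by (auto simp: dist_real_def abs_if split: if_splits)
qed

section \<open>Closure properties of the classes \<open>C\<^sup>k\<close>\<close>

text \<open>The recursion imposes continuity only at the bottom level, so the inclusion needs
  induction; its base is that differentiability implies continuity.\<close>

lemma Ck_on_mono_Suc: "Ck_on (Suc k) \<Omega> f \<Longrightarrow> Ck_on k \<Omega> f"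
proof (induction k arbitrary: f)
  case 0
  then show ?case
    by (auto intro: continuous_at_imp_continuous_on differentiable_imp_continuous_within)
next
  case (Suc k)
  show ?case
    unfolding Ck_on.simps(2)[of k] using Suc.prems Suc.IH unfolding Ck_on.simps(2)[of "Suc k"] by blast
qed

lemma Ck_on_cong:
  assumes "open \<Omega>" "\<And>z. z \<in> \<Omega> \<Longrightarrow> f z = g z" "Ck_on k \<Omega> f"
  shows "Ck_on k \<Omega> g"
  using assms(2,3)
proof (induction k arbitrary: f g)
  case 0
  then show ?case by (simp cong: continuous_on_cong)
next
  case (Suc k)
  have df: "f differentiable (at z)" if "z \<in> \<Omega>" for z
    using Suc.prems that by auto
  have "g differentiable (at z)" if "z \<in> \<Omega>" for z
    using df[OF that] has_derivative_cong_open[where f = f and g = g, OF \<open>open \<Omega>\<close> that Suc.prems(1)]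
    unfolding differentiable_def by simp
  moreover have "Ck_on k \<Omega> (partial_x g)" "Ck_on k \<Omega> (partial_y g)"
    using Suc.IH[of "partial_x f" "partial_x g"] Suc.IH[of "partial_y f" "partial_y g"]
      partial_cong_open[OF \<open>open \<Omega>\<close> _ Suc.prems(1) df] Suc.prems by auto
  ultimately show ?case by simp
qed

text \<open>Lets derivative formulas that hold only on \<Omega> drive the inductions on
  \<open>k\<close> below.\<close>

lemma Ck_on_SucI:
  assumes "open \<Omega>" "\<And>z. z \<in> \<Omega> \<Longrightarrow> f differentiable (at z)"
    and "\<And>z. z \<in> \<Omega> \<Longrightarrow> partial_x f z = fx z" "Ck_on k \<Omega> fx"
    and "\<And>z. z \<in> \<Omega> \<Longrightarrow> partial_y f z = fy z" "Ck_on k \<Omega> fy"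
  shows "Ck_on (Suc k) \<Omega> f"
  using assms(2) Ck_on_cong[OF assms(1) assms(3)[symmetric] assms(4)]
    Ck_on_cong[OF assms(1) assms(5)[symmetric] assms(6)] by simp

lemma Ck_on_const: "Ck_on k \<Omega> (\<lambda>z. c)"
proof (induction k arbitrary: c)
  case (Suc k)
  have "partial_x (\<lambda>z::complex. c) = (\<lambda>z. 0)" "partial_y (\<lambda>z::complex. c) = (\<lambda>z. 0)"
    by (auto simp: partial_const)
  with Suc show ?case by simp
qed simp

lemma Ck_on_add:
  assumes "open \<Omega>" "Ck_on k \<Omega> f" "Ck_on k \<Omega> g"
  shows "Ck_on k \<Omega> (\<lambda>z. f z + g z)"
  using assms(2,3)
proof (induction k arbitrary: f g)
  case 0
  then show ?case by (auto intro: continuous_on_add)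
next
  case (Suc k)
  then show ?case
    by (intro Ck_on_SucI[where fx = "\<lambda>z. partial_x f z + partial_x g z"
          and fy = "\<lambda>z. partial_y f z + partial_y g z"] partial_add Suc.IH \<open>open \<Omega>\<close>) auto
qed

lemma (in bounded_bilinear) Ck_on:
  assumes "open \<Omega>" "Ck_on k \<Omega> f" "Ck_on k \<Omega> g"
  shows "Ck_on k \<Omega> (\<lambda>z. prod (f z) (g z))"
  using assms(2,3)
proof (induction k arbitrary: f g)
  case 0
  then show ?case by (auto intro: continuous_on)
next
  case (Suc k)
  \<comment> \<open>The product rule retains undifferentiated factors, so these must be available at
    level \<open>k\<close> as well.\<close>
  note low = Ck_on_mono_Suc[OF Suc.prems(1)] Ck_on_mono_Suc[OF Suc.prems(2)]
  show ?case
    using Suc.prems low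
    by (intro Ck_on_SucI[where fx = "\<lambda>z. prod (f z) (partial_x g z) + prod (partial_x f z) (g z)"
          and fy = "\<lambda>z. prod (f z) (partial_y g z) + prod (partial_y f z) (g z)"]
        partial Ck_on_add Suc.IH \<open>open \<Omega>\<close>) auto
qed

lemma partial_inverse_sqrt:
  assumes "f differentiable (at z)" "f z > 0"
  shows "(\<lambda>w. inverse (sqrt (f w))) differentiable (at z)"
    "partial_x (\<lambda>w. inverse (sqrt (f w))) z = - (1/2) * inverse (sqrt (f z)) ^ 3 * partial_x f z"
    "partial_y (\<lambda>w. inverse (sqrt (f w))) z = - (1/2) * inverse (sqrt (f z)) ^ 3 * partial_y f z"
proof -
  obtain D where D: "(f has_derivative D) (at z)"
    using assms unfolding differentiable_def by auto
  have *: "((\<lambda>w. inverse (sqrt (f w))) has_derivative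
      (\<lambda>h. - (1/2) * inverse (sqrt (f z)) ^ 3 * D h)) (at z)"
    using assms D
    by (auto intro!: derivative_eq_intros simp: fun_eq_iff field_simps power3_eq_cube)
  then show "(\<lambda>w. inverse (sqrt (f w))) differentiable (at z)"
    unfolding differentiable_def by blast
  show "partial_x (\<lambda>w. inverse (sqrt (f w))) z = - (1/2) * inverse (sqrt (f z)) ^ 3 * partial_x f z"
    "partial_y (\<lambda>w. inverse (sqrt (f w))) z = - (1/2) * inverse (sqrt (f z)) ^ 3 * partial_y f z"
    using partial_eq_has_derivative[OF *] partial_eq_has_derivative[OF D] by simp_all
qed

text \<open>The derivative of \<open>1 / \<surd>f\<close> is a polynomial in \<open>1 / \<surd>f\<close> times the derivative of \<open>f\<close>, which
  makes the induction on \<open>k\<close> self-contained.\<close>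

lemma Ck_on_inverse_sqrt:
  assumes "open \<Omega>" "Ck_on k \<Omega> f" and pos: "\<And>z. z \<in> \<Omega> \<Longrightarrow> f z > 0"
  shows "Ck_on k \<Omega> (\<lambda>z. inverse (sqrt (f z)))"
  using assms(2)
proof (induction k)
  case 0
  then show ?case
    using pos by (simp, intro continuous_on_inverse continuous_on_real_sqrt) (auto simp: less_imp_neq[symmetric])
next
  case (Suc k)
  note mult = bounded_bilinear.Ck_on[OF bounded_bilinear_mult \<open>open \<Omega>\<close>]
  have IH: "Ck_on k \<Omega> (\<lambda>z. inverse (sqrt (f z)))"
    using Suc Ck_on_mono_Suc by blast
  have "Ck_on k \<Omega> (\<lambda>z. - (1/2) * inverse (sqrt (f z)) ^ 3 * g z)" if "Ck_on k \<Omega> g" for g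
    unfolding power3_eq_cube by (intro mult Ck_on_const IH that)
  with Suc.prems pos show ?case
    by (intro Ck_on_SucI[where fx = "\<lambda>z. - (1/2) * inverse (sqrt (f z)) ^ 3 * partial_x f z"
          and fy = "\<lambda>z. - (1/2) * inverse (sqrt (f z)) ^ 3 * partial_y f z"]
        partial_inverse_sqrt \<open>open \<Omega>\<close>) auto
qed

section \<open>The Gauss map\<close>

lemma bounded_bilinear_cross3: "bounded_bilinear cross3"
  using bilinear_conv_bounded_bilinear bilinear_cross by blast

lemma smooth_on_partial:
  assumes "smooth_on \<Omega> f"
  shows "smooth_on \<Omega> (partial_x f)" "smooth_on \<Omega> (partial_y f)"
  using assms unfolding smooth_on_def by (metis Ck_on.simps(2))+

lemma smooth_on_differentiable:
  assumes "smooth_on \<Omega> f" "z \<in> \<Omega>"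
  shows "f differentiable (at z)"
  using assms unfolding smooth_on_def by (metis Ck_on.simps(2))

text \<open>The unit normal is \<open>c\<close> scaled by
  \<open>inverse (sqrt (c \<bullet> c))\<close>, where \<open>c\<close> is the cross product of the
  partials; regularity makes the radicand positive.\<close>

lemma smooth_on_gauss_map:
  assumes "open \<Omega>" "smooth_on \<Omega> X" "regular_surface \<Omega> X"
  shows "smooth_on \<Omega> (gauss_map X)"
  unfolding smooth_on_def
proof
  fix k
  define c where "c z = cross3 (partial_x X z) (partial_y X z)" for z
  have c: "Ck_on k \<Omega> c"
    using smooth_on_partial[OF assms(2)] unfolding c_def smooth_on_def
    by (intro bounded_bilinear.Ck_on[OF bounded_bilinear_cross3 assms(1)]) auto
  have "Ck_on k \<Omega> (\<lambda>z. inverse (sqrt (c z \<bullet> c z)))"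
    using assms(3)
    by (intro Ck_on_inverse_sqrt assms bounded_bilinear.Ck_on[OF bounded_bilinear_inner] c)
      (auto simp: c_def regular_surface_def)
  then have "Ck_on k \<Omega> (\<lambda>z. inverse (sqrt (c z \<bullet> c z)) *\<^sub>R c z)"
    by (intro bounded_bilinear.Ck_on[OF bounded_bilinear_scaleR assms(1)] c)
  then show "Ck_on k \<Omega> (gauss_map X)"
    unfolding gauss_map_def c_def norm_eq_sqrt_inner by (simp cong: if_cong)
qed

text \<open>In the application \<open>a = X\<^sub>x\<close>, \<open>b = X\<^sub>y\<close>, \<open>u = \<^bold>n\<^sub>x\<close>, \<open>v = \<^bold>n\<^sub>y\<close>; the last two hypotheses
  say that the second fundamental form is symmetric and trace-free.\<close>

lemma dilatation_le:
  fixes a b u v :: "real^3"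
  assumes perp: "u \<bullet> cross3 a b = 0" "v \<bullet> cross3 a b = 0"
    and sym: "u \<bullet> b = v \<bullet> a" and trace: "v \<bullet> b = - (u \<bullet> a)"
  shows "((norm u)\<^sup>2 + (norm v)\<^sup>2) * norm (cross3 a b)
    \<le> ((norm a)\<^sup>2 + (norm b)\<^sup>2) * norm (cross3 u v)"
\<comment> \<open>In the degenerate case the left side is zero; otherwise the norm of the cross
  product can be cancelled at the end.\<close>
proof (cases "cross3 a b = 0")
  case False
  define c where "c = cross3 a b"
  \<comment> \<open>With \<open>p = u \<bullet> a\<close> and \<open>q = u \<bullet> b\<close>, the
    inner products form the matrix with rows \<open>(p, q)\<close> and \<open>(q, -p)\<close>, of
    determinant \<open>-s\<close>.\<close>
  define s where "s = (u \<bullet> a)\<^sup>2 + (u \<bullet> b)\<^sup>2"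
  \<comment> \<open>For \<open>w\<close> orthogonal to \<open>c\<close>, the left side is the
    squared norm of \<open>cross3 w c\<close>, which the triple product identity expands.\<close>
  have expand: "(norm w)\<^sup>2 * (norm c)\<^sup>2 = (norm ((w \<bullet> b) *\<^sub>R a - (w \<bullet> a) *\<^sub>R b))\<^sup>2"
    if "w \<bullet> c = 0" for w
    using norm_cross[of w c] that Lagrange[of w a b] by (simp add: c_def)
  \<comment> \<open>Adding the expansions for \<open>u\<close> and \<open>v\<close>, the mixed terms
    in \<open>a \<bullet> b\<close> cancel because the matrix is symmetric and trace-free.\<close>
  have "(norm u)\<^sup>2 * (norm c)\<^sup>2 + (norm v)\<^sup>2 * (norm c)\<^sup>2 = s * ((norm a)\<^sup>2 + (norm b)\<^sup>2)"
    using perp unfolding c_def[symmetric] expand[OF perp(1)[folded c_def]] expand[OF perp(2)[folded c_def]]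
    unfolding power2_norm_eq_inner s_def trace sym[symmetric]
    by (simp add: algebra_simps inner_commute[of b a] power2_eq_square)
  moreover have "s \<le> norm (cross3 u v) * norm c"
  proof -
    \<comment> \<open>The inner product of two cross products is the determinant of the matrix of
      inner products.\<close>
    have "cross3 u v \<bullet> c = - s"
      unfolding c_def dot_cross s_def trace sym[symmetric] by (simp add: power2_eq_square)
    then show ?thesis
      using Cauchy_Schwarz_ineq2[of "cross3 u v" c] by simp
  qed
  then have "s * ((norm a)\<^sup>2 + (norm b)\<^sup>2)
      \<le> norm (cross3 u v) * norm c * ((norm a)\<^sup>2 + (norm b)\<^sup>2)"
    by (intro mult_right_mono) auto
  ultimately have "norm c * (((norm u)\<^sup>2 + (norm v)\<^sup>2) * norm c)
      \<le> norm c * (((norm a)\<^sup>2 + (norm b)\<^sup>2) * norm (cross3 u v))"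
    by (simp add: algebra_simps power2_eq_square)
  with False show ?thesis
    by (simp add: c_def)
qed simp

section \<open>Second derivatives of harmonic surfaces and relations for the Gauss map\<close>

lemma partial_vec_nth:
  fixes f :: "complex \<Rightarrow> real^'n"
  assumes "f differentiable (at z)"
  shows "partial_x (\<lambda>w. f w $ i) z = partial_x f z $ i" "partial_y (\<lambda>w. f w $ i) z = partial_y f z $ i"
  using bounded_linear.partial[OF bounded_linear_vec_nth assms] by simp_all

text \<open>Bridges harmonicity, which is stated for coordinates, and the vector-valued second
  partials.\<close>

lemma second_partial_vec_nth:
  fixes f :: "complex \<Rightarrow> real^'n"
  assumes "open \<Omega>" "smooth_on \<Omega> f" "z \<in> \<Omega>"
    and "(\<lambda>w. f w $ i) = g" "Ck_on 2 \<Omega> g"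
  shows "partial_x (partial_x g) z = partial_x (partial_x f) z $ i"
    "partial_y (partial_x g) z = partial_y (partial_x f) z $ i"
    "partial_x (partial_y g) z = partial_x (partial_y f) z $ i"
    "partial_y (partial_y g) z = partial_y (partial_y f) z $ i"
proof -
  have g: "partial_x g differentiable (at z)" "partial_y g differentiable (at z)"
    using assms by (auto simp: numeral_2_eq_2)
  have f: "f differentiable (at w)" "partial_x f differentiable (at w)"
    "partial_y f differentiable (at w)" if "w \<in> \<Omega>" for w
    using smooth_on_differentiable smooth_on_partial assms(2) that by blast+
  have nth: "partial_x g w = partial_x f w $ i" "partial_y g w = partial_y f w $ i" if "w \<in> \<Omega>" for w
    using partial_vec_nth[OF f(1)[OF that]] assms(4) by auto
  note xx = partial_cong_open[OF assms(1,3) nth(1) g(1)]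
  note yy = partial_cong_open[OF assms(1,3) nth(2) g(2)]
  show "partial_x (partial_x g) z = partial_x (partial_x f) z $ i"
    "partial_y (partial_x g) z = partial_y (partial_x f) z $ i"
    "partial_x (partial_y g) z = partial_x (partial_y f) z $ i"
    "partial_y (partial_y g) z = partial_y (partial_y f) z $ i"
    using xx yy partial_vec_nth f assms(3) by metis+
qed

lemma harmonic_surface_second_partials:
  assumes "open \<Omega>" "harmonic_surface \<Omega> X" "smooth_on \<Omega> X" "z \<in> \<Omega>"
  shows "partial_x (partial_y X) z = partial_y (partial_x X) z"
    "partial_y (partial_y X) z = - partial_x (partial_x X) z"
proof -
  have C2: "Ck_on 2 \<Omega> (\<lambda>w. X w $ i)"
    and "partial_x (partial_x (\<lambda>w. X w $ i)) z + partial_y (partial_y (\<lambda>w. X w $ i)) z = 0" for i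
    using assms by (auto simp: harmonic_surface_def harmonic_on_def)
  note sp = second_partial_vec_nth[OF assms(1,3,4) refl C2]
  show "partial_x (partial_y X) z = partial_y (partial_x X) z"
    using mixed_partials_eq_real[OF assms(1,4) C2] by (simp add: vec_eq_iff sp)
  have "partial_x (partial_x X) z $ i + partial_y (partial_y X) z $ i = 0" for i
    using sp(1,4) \<open>\<And>i. _ i + _ i = 0\<close> by metis
  then show "partial_y (partial_y X) z = - partial_x (partial_x X) z"
    by (simp add: vec_eq_iff add_eq_0_iff)
qed

text \<open>Product rule for a constant function; used for \<open>n \<bullet> n = 1\<close> and for
  orthogonality of \<open>n\<close> to the tangent vectors.\<close>

lemma partial_inner_const:
  fixes f g :: "complex \<Rightarrow> 'a::real_inner"
  assumes "open \<Omega>" "smooth_on \<Omega> f" "smooth_on \<Omega> g" "z \<in> \<Omega>" "\<And>w. w \<in> \<Omega> \<Longrightarrow> f w \<bullet> g w = c"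
  shows "partial_x f z \<bullet> g z = - (f z \<bullet> partial_x g z)"
    "partial_y f z \<bullet> g z = - (f z \<bullet> partial_y g z)"
proof -
  note d = smooth_on_differentiable[OF assms(2,4)] smooth_on_differentiable[OF assms(3,4)]
  note p = bounded_bilinear.partial[OF bounded_bilinear_inner d]
  show "partial_x f z \<bullet> g z = - (f z \<bullet> partial_x g z)"
    "partial_y f z \<bullet> g z = - (f z \<bullet> partial_y g z)"
    using p partial_cong_open[OF assms(1,4,5) p(1)] by (simp_all add: partial_const)
qed

lemma gauss_map_dilatation_le:
  assumes "open \<Omega>" "harmonic_surface \<Omega> X" "smooth_on \<Omega> X" "regular_surface \<Omega> X" "z \<in> \<Omega>"
  defines "n \<equiv> gauss_map X"
  shows "((norm (partial_x n z))\<^sup>2 + (norm (partial_y n z))\<^sup>2)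
      * norm (cross3 (partial_x X z) (partial_y X z))
    \<le> ((norm (partial_x X z))\<^sup>2 + (norm (partial_y X z))\<^sup>2)
      * norm (cross3 (partial_x n z) (partial_y n z))"
proof (rule dilatation_le)
  have smooth: "smooth_on \<Omega> n" "smooth_on \<Omega> (partial_x X)" "smooth_on \<Omega> (partial_y X)"
    using smooth_on_gauss_map smooth_on_partial assms by auto
  have nz: "cross3 (partial_x X w) (partial_y X w) \<noteq> 0" if "w \<in> \<Omega>" for w
    using assms(4) that by (auto simp: regular_surface_def)
  have "n w \<bullet> n w = 1" if "w \<in> \<Omega>" for w
    using nz[OF that] unfolding power2_norm_eq_inner[symmetric] by (simp add: n_def gauss_map_def)
  \<comment> \<open>Here each derivative of \<open>n\<close> satisfies an equation of the form
    \<open>t = - t\<close>, hence is orthogonal to \<open>n\<close>.\<close>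
  note nn = partial_inner_const[OF assms(1) smooth(1,1) assms(5) this]
  have "n w \<bullet> partial_x X w = 0" "n w \<bullet> partial_y X w = 0" for w
    by (simp_all add: n_def gauss_map_def dot_cross_self inner_commute[of "cross3 _ _"])
  note nX = partial_inner_const[OF assms(1) smooth(1,2) assms(5) this(1)]
    partial_inner_const[OF assms(1) smooth(1,3) assms(5) this(2)]
  have cross: "cross3 (partial_x X z) (partial_y X z)
      = norm (cross3 (partial_x X z) (partial_y X z)) *\<^sub>R n z"
    using nz[OF assms(5)] by (simp add: n_def gauss_map_def)
  show "partial_x n z \<bullet> cross3 (partial_x X z) (partial_y X z) = 0"
    "partial_y n z \<bullet> cross3 (partial_x X z) (partial_y X z) = 0"
    using nn by (subst cross, simp add: inner_commute)+
  \<comment> \<open>Moving the derivative from \<open>n\<close> onto the tangent vectors reduces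
    symmetry to equality of mixed partials and trace-freeness to Laplace's equation.\<close>
  show "partial_x n z \<bullet> partial_y X z = partial_y n z \<bullet> partial_x X z"
    "partial_y n z \<bullet> partial_y X z = - (partial_x n z \<bullet> partial_x X z)"
    using nX harmonic_surface_second_partials[OF assms(1,2,3,5)] by simp_all
qed

theorem corollary1p2:
  fixes \<Omega> :: "complex set" and X :: "complex \<Rightarrow> real^3" and K :: real
  assumes "open \<Omega>" and "connected \<Omega>"
    and "harmonic_surface \<Omega> X"
    and "regular_surface \<Omega> X"
    and "K \<ge> 1"
    and "quasiconformal_on K \<Omega> X"
    and "regular_gauss_map \<Omega> (gauss_map X)"
  shows "quasiconformal_on K \<Omega> (gauss_map X)"
  unfolding quasiconformal_on_def
proof (intro conjI ballI)
  have smooth: "smooth_on \<Omega> X"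
    using assms(6) by (simp add: quasiconformal_on_def)
  then show "smooth_on \<Omega> (gauss_map X)"
    using smooth_on_gauss_map assms by blast
  fix z assume z: "z \<in> \<Omega>"
  define W where "W = norm (cross3 (partial_x X z) (partial_y X z))"
  define V where "V = norm (cross3 (partial_x (gauss_map X) z) (partial_y (gauss_map X) z))"
  have "W > 0"
    using assms(4) z by (simp add: W_def regular_surface_def)
  \<comment> \<open>The factor \<open>W\<close> carries the comparison with the dilatation of
    \<open>X\<close> and is cancelled at the end, being positive by regularity.\<close>
  have "((norm (partial_x (gauss_map X) z))\<^sup>2 + (norm (partial_y (gauss_map X) z))\<^sup>2) * W
      \<le> ((norm (partial_x X z))\<^sup>2 + (norm (partial_y X z))\<^sup>2) * V"
    unfolding W_def V_def using gauss_map_dilatation_le assms z smooth by blast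
  also have "\<dots> \<le> ((K + 1 / K) * W) * V"
    using assms(6) z unfolding quasiconformal_on_def W_def V_def by (intro mult_right_mono) auto
  also have "\<dots> = ((K + 1 / K) * V) * W"
    by simp
  finally show "(norm (partial_x (gauss_map X) z))\<^sup>2 + (norm (partial_y (gauss_map X) z))\<^sup>2
      \<le> (K + 1 / K) * V"
    using \<open>W > 0\<close> by (rule mult_right_le_imp_le)
qed

end
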